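(* Let $G=(V,E)$ be a finite connected graph with nonnegative resistance curvature, i.e. $\kappa_v\ge 0$ for all $v\in V$. Then for any probability measure $\mu$ on $V$, $$\min_{a\in V}\sum_{v\in V}\Omega_{av}\,\mu(v)\leq \Big(\sum_{v\in V}\kappa_v\Big)^{-1}\leq \max_{b\in V}\sum_{v\in V}\Omega_{bv}\,\mu(v).$$ Moreover, $\big(\sum_{v\in V}\kappa_v\big)^{-1}$ is the unique real number $\alpha$ such that $\min_{a\in V}\sum_{v}\Omega_{av}\mu(v)\le\alpha\le\max_{b\in V}\sum_v\Omega_{bv}\mu(v)$ holds for every probability measure $\mu$ on $V$.
   Context: Throughout, $G=(V,E)$ is a finite, simple, connected graph with vertices $v_1,\dots,v_n$, $n\ge 2$. Let $D$ be the diagonal degree matrix, $A$ the adjacency matrix, and $\Gamma = D-A+\frac1n J$, where $J$ is the $n\times n$ all-ones matrix. The resistance matrix $\Omega$ is defined by $\Omega_{ij}=(\Gamma^{-1})_{ii}+(\Gamma^{-1})_{jj}-2(\Gamma^{-1})_{ij}$ (indexed by vertices); it is invertible. The resistance curvature is the unique vector $\kappa\in\mathbb{R}^n$ with $\Omega\kappa=\mathbf{1}$, $\mathbf 1=(1,\dots,1)$; $\kappa_v$ is the curvature at vertex $v$. *)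

theory Defs
  imports "HOL-Analysis.Analysis" "HOL-Probability.Probability"
begin

text \<open>
  A graph is given by its adjacency relation on a finite vertex type \<open>'n\<close>; each undirected edge
  occurs in both orientations.
\<close>

definition simple_graph :: "('n \<times> 'n) set \<Rightarrow> bool" where
  "simple_graph E \<longleftrightarrow> sym E \<and> irrefl E"

definition connected_graph :: "('n \<times> 'n) set \<Rightarrow> bool" where
  "connected_graph E \<longleftrightarrow> (\<forall>u v. (u, v) \<in> E\<^sup>*)"

definition degree_matrix :: "('n::finite \<times> 'n) set \<Rightarrow> real^'n^'n" where
  "degree_matrix E = (\<chi> i j. if i = j then real (card {u. (i, u) \<in> E}) else 0)"

definition adjacency_matrix :: "('n::finite \<times> 'n) set \<Rightarrow> real^'n^'n" where
  "adjacency_matrix E = (\<chi> i j. if (i, j) \<in> E then 1 else 0)"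

definition ones_matrix :: "real^'n::finite^'n" where
  "ones_matrix = (\<chi> i j. 1)"

definition Gamma_matrix :: "('n::finite \<times> 'n) set \<Rightarrow> real^'n^'n" where
  "Gamma_matrix E =
     degree_matrix E - adjacency_matrix E + (1 / real CARD('n)) *\<^sub>R ones_matrix"

definition resistance_matrix :: "('n::finite \<times> 'n) set \<Rightarrow> real^'n^'n" where
  "resistance_matrix E =
     (let M = matrix_inv (Gamma_matrix E) in \<chi> i j. M $ i $ i + M $ j $ j - 2 * M $ i $ j)"

text \<open>
  For a connected simple graph on at least two vertices the resistance matrix is invertible, so
  the description below denotes an actual vector. On a single vertex it does not.
\<close>

definition resistance_curvature :: "('n::finite \<times> 'n) set \<Rightarrow> real^'n" where
  "resistance_curvature E = (THE k. resistance_matrix E *v k = (\<chi> i. 1))"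

text \<open>
  Probability measures on the finite vertex set are rendered as \<open>'n pmf\<close>; \<open>pmf \<mu> v\<close> is the
  mass of the point \<open>v\<close>.
\<close>

definition resistance_potential :: "('n::finite \<times> 'n) set \<Rightarrow> 'n pmf \<Rightarrow> 'n \<Rightarrow> real" where
  "resistance_potential E \<mu> a = (\<Sum>v\<in>UNIV. resistance_matrix E $ a $ v * pmf \<mu> v)"

end

theory Submission
  imports Defs
begin

text \<open>
  The resistance matrix \<open>\<Omega>\<close> is symmetric and \<open>\<Omega> \<kappa> = 1\<close>, so averaging the potential \<open>\<Omega> \<mu>\<close> against
  the weights \<open>\<kappa>\<close> gives \<open>\<kappa> \<bullet> \<Omega> \<mu> = 1 \<bullet> \<mu> = 1\<close>; dividing by the total curvature \<open>s\<close>, a weighted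
  mean of the potential equals \<open>1/s\<close>. For the measure \<open>\<mu> = \<kappa>/s\<close> the potential is constantly
  \<open>1/s\<close>, which forces uniqueness. Invertibility of \<open>\<Omega>\<close> comes from its signature: it is negative
  definite on the vectors with coordinate sum \<open>0\<close>, because \<open>\<Gamma>\<close> is positive definite, and its
  off-diagonal entries are positive.
\<close>

section \<open>Inverses of symmetric and positive definite matrices\<close>

lemma invertible_if_trivial_kernel:
  fixes A :: "real^'n^'n"
  assumes "\<And>x. A *v x = 0 \<Longrightarrow> x = 0"
  shows "invertible A"
  using assms matrix_left_invertible_ker[of A] invertible_left_inverse by blast

lemma
  fixes A :: "'a::semiring_1^'n^'m"
  assumes "invertible A"
  shows matrix_inv_right: "A ** matrix_inv A = mat 1"
    and matrix_inv_left: "matrix_inv A ** A = mat 1"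
  using someI_ex[OF assms[unfolded invertible_def]] by (simp_all add: matrix_inv_def)

lemma inner_symmetric_matrix:
  fixes A :: "real^'n^'n"
  assumes "transpose A = A"
  shows "x \<bullet> (A *v y) = y \<bullet> (A *v x)"
  by (metis assms dot_lmul_matrix inner_commute transpose_matrix_vector)

lemma transpose_matrix_inv_symmetric:
  fixes A :: "real^'n^'n"
  assumes "invertible A" "transpose A = A"
  shows "transpose (matrix_inv A) = matrix_inv A"
proof -
  have "A ** transpose (matrix_inv A) = mat 1"
    by (metis assms matrix_inv_left matrix_transpose_mul transpose_mat)
  then show ?thesis
    by (metis assms(1) matrix_inv_left matrix_mul_assoc matrix_mul_lid matrix_mul_rid)
qed

text \<open>Substituting \<open>y = matrix_inv A *v x\<close> turns the quadratic form of the
  inverse at \<open>x\<close> into that of \<open>A\<close> at \<open>y\<close>, and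
  \<open>y\<close> is nonzero because \<open>A *v y = x\<close>.\<close>

lemma matrix_inv_pos_def:
  fixes A :: "real^'n^'n"
  assumes inv: "invertible A" and pos: "\<And>x. x \<noteq> 0 \<Longrightarrow> 0 < x \<bullet> (A *v x)" and "x \<noteq> 0"
  shows "0 < x \<bullet> (matrix_inv A *v x)"
proof -
  have *: "A *v (matrix_inv A *v x) = x"
    by (simp add: matrix_vector_mul_assoc matrix_inv_right[OF inv])
  then have "matrix_inv A *v x \<noteq> 0"
    using \<open>x \<noteq> 0\<close> by auto
  from pos[OF this] show ?thesis
    by (simp add: * inner_commute)
qed

section \<open>Positive definiteness of \<open>Gamma_matrix\<close>\<close>

lemma Gamma_matrix_nth:
  "Gamma_matrix E $ i $ j =
     (if i = j then real (card {u. (i, u) \<in> E}) else 0) - of_bool ((i, j) \<in> E) + 1 / real CARD('n)"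
  for E :: "('n::finite \<times> 'n) set"
  by (simp add: Gamma_matrix_def degree_matrix_def adjacency_matrix_def ones_matrix_def)

lemma transpose_Gamma_matrix:
  assumes "sym E"
  shows "transpose (Gamma_matrix E) = Gamma_matrix E"
  using assms by (auto simp: vec_eq_iff transpose_def Gamma_matrix_nth dest: symD)

text \<open>This is the Dirichlet energy of the Laplacian plus the contribution of the all-ones
  matrix. The factor 2 is there because the double sum meets each edge in both orientations.\<close>

lemma inner_Gamma_matrix:
  fixes E :: "('n::finite \<times> 'n) set"
  assumes "sym E"
  shows "2 * (x \<bullet> (Gamma_matrix E *v x)) =
    (\<Sum>i\<in>UNIV. \<Sum>j\<in>UNIV. of_bool ((i, j) \<in> E) * (x $ i - x $ j)\<^sup>2)
      + 2 / real CARD('n) * (\<Sum>i\<in>UNIV. x $ i)\<^sup>2"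
proof -
  let ?A = "\<lambda>i j. of_bool ((i, j) \<in> E) :: real"
  let ?S = "\<Sum>i\<in>UNIV. x $ i"
  have card: "real (card {u. (i, u) \<in> E}) = (\<Sum>j\<in>UNIV. ?A i j)" for i
    by (simp add: sum.If_cases of_bool_def)
  have row: "(Gamma_matrix E *v x) $ i =
      (\<Sum>j\<in>UNIV. ?A i j * x $ i - ?A i j * x $ j) + 1 / real CARD('n) * ?S" for i
  proof -
    have "(Gamma_matrix E *v x) $ i =
      (\<Sum>j\<in>UNIV. (if i = j then real (card {u. (i, u) \<in> E}) * x $ j else 0)
         - ?A i j * x $ j + 1 / real CARD('n) * x $ j)"
      unfolding matrix_vector_mult_def
      by (auto simp: Gamma_matrix_nth algebra_simps intro!: sum.cong)
    also have "\<dots> = real (card {u. (i, u) \<in> E}) * x $ i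
         - (\<Sum>j\<in>UNIV. ?A i j * x $ j) + 1 / real CARD('n) * ?S"
      by (simp only: sum.distrib sum_subtractf sum_distrib_left) simp
    finally show ?thesis
      by (simp only: card sum_subtractf sum_distrib_right)
  qed
  have form: "x \<bullet> (Gamma_matrix E *v x) =
      (\<Sum>i\<in>UNIV. \<Sum>j\<in>UNIV. ?A i j * (x $ i)\<^sup>2 - ?A i j * (x $ i * x $ j)) + 1 / real CARD('n) * ?S\<^sup>2"
    unfolding inner_vec_def row
    by (simp add: distrib_left sum.distrib sum_distrib_left sum_distrib_right power2_eq_square
        sum_divide_distrib algebra_simps)
  \<comment> \<open>Exchanging the order of summation and then using \<open>sym E\<close> trades the
    two endpoints.\<close>
  have swap: "(\<Sum>i\<in>UNIV. \<Sum>j\<in>UNIV. ?A i j * (x $ j)\<^sup>2) = (\<Sum>i\<in>UNIV. \<Sum>j\<in>UNIV. ?A i j * (x $ i)\<^sup>2)"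
    by (subst sum.swap) (intro sum.cong refl, use assms in \<open>auto dest: symD\<close>)
  have "(\<Sum>i\<in>UNIV. \<Sum>j\<in>UNIV. ?A i j * (x $ i - x $ j)\<^sup>2) =
      (\<Sum>i\<in>UNIV. \<Sum>j\<in>UNIV. ?A i j * (x $ i)\<^sup>2) + (\<Sum>i\<in>UNIV. \<Sum>j\<in>UNIV. ?A i j * (x $ j)\<^sup>2)
       - 2 * (\<Sum>i\<in>UNIV. \<Sum>j\<in>UNIV. ?A i j * (x $ i * x $ j))"
    by (simp only: sum_distrib_left flip: sum.distrib sum_subtractf)
      (intro sum.cong refl, simp add: power2_eq_square algebra_simps)
  then show ?thesis
    unfolding form swap sum_subtractf by simp
qed

text \<open>If the form is not positive, both nonnegative summands vanish. The energy makes
  \<open>x\<close> constant along edges, hence everywhere by connectedness, and the squared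
  coordinate sum forces that constant to be 0.\<close>

lemma Gamma_matrix_pos_def:
  fixes E :: "('n::finite \<times> 'n) set"
  assumes "sym E" "connected_graph E" "x \<noteq> 0"
  shows "0 < x \<bullet> (Gamma_matrix E *v x)"
proof (rule ccontr)
  let ?Q = "\<Sum>i\<in>UNIV. \<Sum>j\<in>UNIV. of_bool ((i, j) \<in> E) * (x $ i - x $ j)\<^sup>2"
  let ?R = "2 / real CARD('n) * (\<Sum>i\<in>UNIV. x $ i)\<^sup>2"
  assume "\<not> ?thesis"
  then have "?Q + ?R \<le> 0"
    using inner_Gamma_matrix[OF assms(1), of x] by linarith
  moreover have "?Q \<ge> 0" "?R \<ge> 0"
    by (auto intro!: sum_nonneg)
  ultimately have Q: "?Q = 0" and R: "?R = 0"
    by linarith+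
  have edge: "x $ i = x $ j" if "(i, j) \<in> E" for i j
    using Q that by (auto simp: sum_nonneg_eq_0_iff sum_nonneg)
  have const: "x $ i = x $ j" for i j
  proof -
    have "(i, j) \<in> E\<^sup>*"
      using assms(2) by (simp add: connected_graph_def)
    then show ?thesis
      by induction (use edge in auto)
  qed
  have "x $ i = 0" for i
  proof -
    have "(\<Sum>j\<in>UNIV. x $ j) = (\<Sum>j\<in>(UNIV::'n set). x $ i)"
      using const by (intro sum.cong) auto
    then show ?thesis
      using R by simp
  qed
  then show False
    using assms(3) by (simp add: vec_eq_iff)
qed

lemma
  assumes "sym E" "connected_graph E"
  shows invertible_Gamma_matrix: "invertible (Gamma_matrix E)"
    and transpose_inv_Gamma_matrix:
      "transpose (matrix_inv (Gamma_matrix E)) = matrix_inv (Gamma_matrix E)"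
    and inv_Gamma_matrix_pos_def:
      "x \<noteq> 0 \<Longrightarrow> 0 < x \<bullet> (matrix_inv (Gamma_matrix E) *v x)"
proof -
  show inv: "invertible (Gamma_matrix E)"
    by (rule invertible_if_trivial_kernel)
      (metis Gamma_matrix_pos_def[OF assms] inner_zero_right less_irrefl)
  show "transpose (matrix_inv (Gamma_matrix E)) = matrix_inv (Gamma_matrix E)"
    using inv transpose_Gamma_matrix[OF assms(1)] by (rule transpose_matrix_inv_symmetric)
  show "x \<noteq> 0 \<Longrightarrow> 0 < x \<bullet> (matrix_inv (Gamma_matrix E) *v x)"
    using inv Gamma_matrix_pos_def[OF assms] by (rule matrix_inv_pos_def)
qed

section \<open>Signature and invertibility of the resistance matrix\<close>

lemma transpose_resistance_matrix:
  assumes "sym E" "connected_graph E"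
  shows "transpose (resistance_matrix E) = resistance_matrix E"
  using transpose_inv_Gamma_matrix[OF assms]
  by (simp add: resistance_matrix_def Let_def transpose_def vec_eq_iff)

text \<open>The entry is the quadratic form of the inverse of \<open>Gamma_matrix E\<close> at the
  difference of two basis vectors.\<close>

lemma resistance_matrix_pos:
  assumes "sym E" "connected_graph E" "i \<noteq> j"
  shows "0 < resistance_matrix E $ i $ j"
proof -
  let ?M = "matrix_inv (Gamma_matrix E)"
  let ?x = "axis i 1 - axis j 1 :: real^'a"
  have sym: "?M $ j $ i = ?M $ i $ j"
    using transpose_inv_Gamma_matrix[OF assms(1,2)] by (simp add: transpose_def vec_eq_iff)
  have "?x \<noteq> 0"
    using assms(3) by (auto simp: axis_def vec_eq_iff)
  from inv_Gamma_matrix_pos_def[OF assms(1,2) this] show ?thesis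
    by (simp add: resistance_matrix_def Let_def matrix_vector_mult_diff_distrib inner_diff_left
        inner_diff_right inner_axis' matrix_vector_mul_component inner_axis sym)
qed

text \<open>The two diagonal terms in an entry depend on the row alone or on the column alone, so
  each is killed by the zero coordinate sum: one inside the product with \<open>x\<close>, the other
  on pairing with \<open>x\<close>.\<close>

lemma inner_resistance_matrix_sum_zero:
  assumes "(\<Sum>i\<in>UNIV. x $ i) = 0"
  shows "x \<bullet> (resistance_matrix E *v x) = - 2 * (x \<bullet> (matrix_inv (Gamma_matrix E) *v x))"
proof -
  define M where "M = matrix_inv (Gamma_matrix E)"
  have row: "(resistance_matrix E *v x) $ i = (\<Sum>j\<in>UNIV. M $ j $ j * x $ j) - 2 * (M *v x) $ i" for i
  proof -
    have "(resistance_matrix E *v x) $ i =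
       (\<Sum>j\<in>UNIV. M $ i $ i * x $ j + M $ j $ j * x $ j - 2 * (M $ i $ j * x $ j))"
      by (simp add: resistance_matrix_def Let_def matrix_vector_mult_def M_def algebra_simps)
    also have "\<dots> = M $ i $ i * (\<Sum>j\<in>UNIV. x $ j) + (\<Sum>j\<in>UNIV. M $ j $ j * x $ j) - 2 * (M *v x) $ i"
      by (simp add: sum.distrib sum_subtractf sum_distrib_left matrix_vector_mult_def)
    finally show ?thesis
      using assms by simp
  qed
  have "x \<bullet> (resistance_matrix E *v x) =
     (\<Sum>i\<in>UNIV. x $ i * (\<Sum>j\<in>UNIV. M $ j $ j * x $ j)) - 2 * (x \<bullet> (M *v x))"
    unfolding inner_vec_def row
    by (simp add: right_diff_distrib sum_subtractf sum_distrib_left mult.left_commute)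
  then show ?thesis
    using assms by (simp add: M_def flip: sum_distrib_right)
qed

lemma resistance_matrix_neg_def_sum_zero:
  assumes "sym E" "connected_graph E" "(\<Sum>i\<in>UNIV. x $ i) = 0" "x \<noteq> 0"
  shows "x \<bullet> (resistance_matrix E *v x) < 0"
  using inner_resistance_matrix_sum_zero[OF assms(3), of E]
    inv_Gamma_matrix_pos_def[OF assms(1,2,4)] by linarith

text \<open>Adding a multiple of a kernel vector does not change the quadratic form. A kernel vector
  with nonzero sum could thus move a vector of positive form into the sum-zero hyperplane, where the
  form is never positive. With sum zero, negative definiteness leaves only
  \<open>x = 0\<close>.\<close>

lemma invertible_resistance_matrix:
  fixes E :: "('n::finite \<times> 'n) set"
  assumes "CARD('n) \<ge> 2" "sym E" "connected_graph E"
  shows "invertible (resistance_matrix E)"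
proof (rule invertible_if_trivial_kernel)
  fix x :: "real^'n"
  let ?R = "resistance_matrix E"
  assume ker: "?R *v x = 0"
  define s where "s = (\<Sum>i\<in>UNIV. x $ i)"
  have "s = 0"
  proof (rule ccontr)
    assume "s \<noteq> 0"
    obtain i j :: 'n where "i \<noteq> j"
      using assms(1) by (metis One_nat_def card_le_Suc0_iff_eq finite not_less_eq_eq numeral_2_eq_2 UNIV_I)
    \<comment> \<open>The diagonal of \<open>?R\<close> is zero, so the form at \<open>w\<close> is
      a sum of two positive entries. The coordinate sum of \<open>w\<close> is 2, which explains the
      coefficient \<open>2 / s\<close> in \<open>y\<close>.\<close>
    define w :: "real^'n" where "w = axis i 1 + axis j 1"
    define y where "y = w - (2 / s) *\<^sub>R x"
    have "(\<Sum>k\<in>UNIV. w $ k) = 2"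
      by (simp add: w_def axis_def sum.distrib)
    then have "(\<Sum>k\<in>UNIV. y $ k) = 0"
      using \<open>s \<noteq> 0\<close> by (simp add: y_def sum_subtractf flip: sum_distrib_left sum_divide_distrib s_def)
    then have "y \<bullet> (?R *v y) \<le> 0"
      using resistance_matrix_neg_def_sum_zero[OF assms(2,3), of y] by (cases "y = 0") auto
    moreover have "y \<bullet> (?R *v y) = w \<bullet> (?R *v w)"
    proof -
      have "?R *v y = ?R *v w"
        by (simp add: y_def matrix_vector_mult_diff_distrib matrix_vector_mult_scaleR ker)
      moreover have "x \<bullet> (?R *v w) = 0"
        by (simp add: inner_symmetric_matrix[OF transpose_resistance_matrix[OF assms(2,3)], of x] ker)
      ultimately show ?thesis
        by (simp add: y_def inner_diff_left)
    qed
    moreover have "w \<bullet> (?R *v w) = ?R $ i $ j + ?R $ j $ i"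
    proof -
      have "?R $ k $ k = 0" for k
        by (simp add: resistance_matrix_def Let_def)
      then show ?thesis
        by (simp add: w_def matrix_vector_right_distrib inner_add_left inner_add_right inner_axis'
            matrix_vector_mul_component inner_axis)
    qed
    ultimately show False
      using resistance_matrix_pos[OF assms(2,3), of i j] resistance_matrix_pos[OF assms(2,3), of j i]
        \<open>i \<noteq> j\<close> by simp
  qed
  then show "x = 0"
    using resistance_matrix_neg_def_sum_zero[OF assms(2,3), of x] ker by (auto simp: s_def)
qed

section \<open>Curvature as weights for the potential\<close>

lemma resistance_matrix_mult_curvature:
  fixes E :: "('n::finite \<times> 'n) set"
  assumes "CARD('n) \<ge> 2" "sym E" "connected_graph E"
  shows "resistance_matrix E *v resistance_curvature E = (\<chi> i. 1)"
proof -
  note inv = invertible_resistance_matrix[OF assms]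
  \<comment> \<open>Unique existence is what makes the \<open>THE\<close> in
    \<open>resistance_curvature\<close> denote the solution.\<close>
  have "\<exists>!k. resistance_matrix E *v k = (\<chi> i. 1)"
    by (metis inv matrix_inv_left matrix_inv_right matrix_vector_mul_assoc matrix_vector_mul_lid)
  then show ?thesis
    unfolding resistance_curvature_def by (rule theI')
qed

lemma sum_curvature_potential:
  fixes E :: "('n::finite \<times> 'n) set"
  assumes "CARD('n) \<ge> 2" "sym E" "connected_graph E"
  shows "(\<Sum>a\<in>UNIV. resistance_curvature E $ a * resistance_potential E \<mu> a) = 1"
proof -
  let ?m = "\<chi> v. pmf \<mu> v"
  have "(\<Sum>a\<in>UNIV. resistance_curvature E $ a * resistance_potential E \<mu> a) =
      resistance_curvature E \<bullet> (resistance_matrix E *v ?m)"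
    by (simp add: inner_vec_def resistance_potential_def matrix_vector_mult_def)
  also have "\<dots> = ?m \<bullet> (\<chi> i. 1)"
    by (simp add: inner_symmetric_matrix[OF transpose_resistance_matrix[OF assms(2,3)],
          of "resistance_curvature E"] resistance_matrix_mult_curvature[OF assms])
  also have "\<dots> = 1"
    by (simp add: inner_vec_def sum_pmf_eq_1)
  finally show ?thesis .
qed

text \<open>The curvature is not the zero vector, since its image is the all-ones vector; a
  nonnegative vector with a nonzero entry has positive sum. This justifies dividing by the total
  curvature.\<close>

lemma sum_curvature_pos:
  fixes E :: "('n::finite \<times> 'n) set"
  assumes "CARD('n) \<ge> 2" "sym E" "connected_graph E" "\<And>v. resistance_curvature E $ v \<ge> 0"
  shows "0 < (\<Sum>v\<in>UNIV. resistance_curvature E $ v)"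
proof -
  have "resistance_curvature E \<noteq> 0"
    using resistance_matrix_mult_curvature[OF assms(1-3)] by (metis matrix_vector_mult_0_right vec_lambda_beta zero_index zero_neq_one)
  then obtain v where "resistance_curvature E $ v \<noteq> 0"
    by (auto simp: vec_eq_iff)
  then show ?thesis
    using assms(4) by (intro sum_pos2[of UNIV v]) (auto simp: less_le)
qed

lemma exists_constant_potential:
  fixes E :: "('n::finite \<times> 'n) set"
  assumes "CARD('n) \<ge> 2" "sym E" "connected_graph E" "\<And>v. resistance_curvature E $ v \<ge> 0"
  shows "\<exists>\<mu>. \<forall>a. resistance_potential E \<mu> a = inverse (\<Sum>v\<in>UNIV. resistance_curvature E $ v)"
proof -
  let ?k = "resistance_curvature E"
  define s where "s = (\<Sum>v\<in>UNIV. ?k $ v)"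
  have "s > 0"
    using sum_curvature_pos[OF assms] by (simp add: s_def)
  \<comment> \<open>\<open>embed_pmf\<close> has the prescribed point masses once these are
    nonnegative and have integral 1 over the counting measure.\<close>
  have "(\<integral>\<^sup>+ v. ennreal (?k $ v / s) \<partial>count_space UNIV) = ennreal (\<Sum>v\<in>UNIV. ?k $ v / s)"
    using assms(4) \<open>s > 0\<close> by (simp add: nn_integral_count_space_finite sum_ennreal)
  also have "\<dots> = 1"
    using \<open>s > 0\<close> by (simp flip: sum_divide_distrib s_def)
  finally have pmf: "pmf (embed_pmf (\<lambda>v. ?k $ v / s)) v = ?k $ v / s" for v
    using assms(4) \<open>s > 0\<close> by (intro pmf_embed_pmf) auto
  have "resistance_potential E (embed_pmf (\<lambda>v. ?k $ v / s)) a = inverse s" for a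
  proof -
    have "resistance_potential E (embed_pmf (\<lambda>v. ?k $ v / s)) a = (resistance_matrix E *v ?k) $ a / s"
      by (simp add: resistance_potential_def pmf matrix_vector_mult_def sum_divide_distrib)
    then show ?thesis
      by (simp add: resistance_matrix_mult_curvature[OF assms(1-3)] field_simps)
  qed
  then show ?thesis
    unfolding s_def by blast
qed

text \<open>The weighted mean of \<open>f\<close> lies between its extremes, and the normalisation
  in the last assumption makes this mean the inverse of the total weight.\<close>

lemma
  fixes f w :: "'n::finite \<Rightarrow> real"
  assumes "\<And>a. 0 \<le> w a" "0 < sum w UNIV" "(\<Sum>a\<in>UNIV. w a * f a) = 1"
  shows Min_le_inverse_weight: "(MIN a. f a) \<le> inverse (sum w UNIV)"
    and inverse_weight_le_Max: "inverse (sum w UNIV) \<le> (MAX a. f a)"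
proof -
  have "sum w UNIV * (MIN a. f a) \<le> (\<Sum>a\<in>UNIV. w a * f a)"
    unfolding sum_distrib_right using assms(1) by (intro sum_mono mult_left_mono) auto
  then show "(MIN a. f a) \<le> inverse (sum w UNIV)"
    using assms(2,3) by (simp add: field_simps)
  have "(\<Sum>a\<in>UNIV. w a * f a) \<le> sum w UNIV * (MAX a. f a)"
    unfolding sum_distrib_right using assms(1) by (intro sum_mono mult_left_mono) auto
  then show "inverse (sum w UNIV) \<le> (MAX a. f a)"
    using assms(2,3) by (simp add: field_simps)
qed

theorem theorem5:
  fixes E :: "('n::finite \<times> 'n) set"
  assumes "CARD('n) \<ge> 2"
    and "simple_graph E"
    and "connected_graph E"
    and "\<forall>v. resistance_curvature E $ v \<ge> 0"
  shows "(\<forall>\<mu> :: 'n pmf.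
            (MIN a. resistance_potential E \<mu> a)
              \<le> inverse (\<Sum>v\<in>UNIV. resistance_curvature E $ v) \<and>
            inverse (\<Sum>v\<in>UNIV. resistance_curvature E $ v)
              \<le> (MAX b. resistance_potential E \<mu> b)) \<and>
         (\<forall>\<alpha> :: real.
            (\<forall>\<mu> :: 'n pmf.
               (MIN a. resistance_potential E \<mu> a) \<le> \<alpha> \<and>
               \<alpha> \<le> (MAX b. resistance_potential E \<mu> b))
            \<longrightarrow> \<alpha> = inverse (\<Sum>v\<in>UNIV. resistance_curvature E $ v))"
proof -
  have sym: "sym E"
    using assms(2) by (simp add: simple_graph_def)
  note graph = assms(1) sym assms(3)
  have nonneg: "\<And>v. resistance_curvature E $ v \<ge> 0"
    using assms(4) by simp
  note bounds = nonneg sum_curvature_pos[OF graph nonneg] sum_curvature_potential[OF graph]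
  \<comment> \<open>For this measure the minimum and the maximum coincide, so every admissible
    \<alpha> is squeezed to their common value.\<close>
  obtain \<mu> where "resistance_potential E \<mu> =
      (\<lambda>_. inverse (\<Sum>v\<in>UNIV. resistance_curvature E $ v))"
    using exists_constant_potential[OF graph nonneg] by blast
  then have "(MIN a. resistance_potential E \<mu> a) = inverse (\<Sum>v\<in>UNIV. resistance_curvature E $ v)"
    "(MAX a. resistance_potential E \<mu> a) = inverse (\<Sum>v\<in>UNIV. resistance_curvature E $ v)"
    by simp_all
  then show ?thesis
    using Min_le_inverse_weight[OF bounds] inverse_weight_le_Max[OF bounds]
    by (metis order_antisym)
qed

end
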